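(* Let $m, n$ be positive integers with $m$ even and $n$ odd, and let $k$ be an integer with $k \geq f_{n-2}(m) + 1$. Put $$s = (-1)^n f_n(m) f_{n-1}(m) + k f_{n+1}(m), \quad t = (-1)^{n-1} f_{n-1}(m)^2 - k f_n(m), \quad \beta(n,m,k) = \sqrt{s^2 - 4t}.$$ Then $$\beta(n,m,k) = [s; \overline{\mathbf w(m), 2s}],$$ where $\mathbf w(m) = (\frac{m}{2}, 2m, \frac{m}{2}, 2m, \ldots, \frac{m}{2}, 2m, \frac{m}{2})$ is the sequence of length $n$ alternating $\frac m2$ and $2m$, starting and ending with $\frac m2$.
   Context: The Fibonacci polynomials $f_h(m)$, for a fixed integer $m$, are defined by $f_0(m) = 0$, $f_1(m) = 1$, $f_h(m) = m f_{h-1}(m) + f_{h-2}(m)$ for $h \geq 2$, and $f_{-h}(m) = (-1)^{h-1} f_h(m)$ for $h \geq 1$. $[b_0; b_1, b_2, \ldots]$ denotes a simple continued fraction, and an overline denotes the periodically repeated block. *)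

theory Defs
  imports Complex_Main
begin

fun fib_nat :: "nat \<Rightarrow> int \<Rightarrow> int" where
  "fib_nat 0 m = 0"
| "fib_nat (Suc 0) m = 1"
| "fib_nat (Suc (Suc h)) m = m * fib_nat (Suc h) m + fib_nat h m"

(* f_h(m) for an arbitrary integer index h, using f_(-h)(m) = (-1)^(h-1) f_h(m) for h >= 1. *)
definition fib_poly :: "int \<Rightarrow> int \<Rightarrow> int" where
  "fib_poly h m =
     (if h \<ge> 0 then fib_nat (nat h) m
      else (-1) ^ (nat (- h) - 1) * fib_nat (nat (- h)) m)"

fun cf_convergent :: "(nat \<Rightarrow> int) \<Rightarrow> nat \<Rightarrow> real" where
  "cf_convergent b 0 = of_int (b 0)"
| "cf_convergent b (Suc j) = of_int (b 0) + 1 / cf_convergent (\<lambda>i. b (Suc i)) j"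

(* x = [b 0; b 1, b 2, ...] as an infinite simple continued fraction: only the partial
   quotients after the first have to be positive. *)
definition has_simple_cf :: "real \<Rightarrow> (nat \<Rightarrow> int) \<Rightarrow> bool" where
  "has_simple_cf x b \<longleftrightarrow> (\<forall>i\<ge>1. b i > 0) \<and> cf_convergent b \<longlonglongrightarrow> x"

(* The sequence b0, ws, ws, ws, ..., for a nonempty block ws. As usual for the overline
   notation, the block is not required to have minimal length. *)
definition periodic_after :: "int \<Rightarrow> int list \<Rightarrow> nat \<Rightarrow> int" where
  "periodic_after b0 ws i = (if i = 0 then b0 else ws ! ((i - 1) mod length ws))"

definition w_block :: "nat \<Rightarrow> int \<Rightarrow> int list" where
  "w_block n m = map (\<lambda>i. if even i then m div 2 else 2 * m) [0..<n]"

definition s_val :: "nat \<Rightarrow> int \<Rightarrow> int \<Rightarrow> int" where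
  "s_val n m k = (-1) ^ n * fib_poly (int n) m * fib_poly (int n - 1) m
                 + k * fib_poly (int n + 1) m"

(* The natural-number exponent n - 1 is intended for n >= 1 only. *)
definition t_val :: "nat \<Rightarrow> int \<Rightarrow> int \<Rightarrow> int" where
  "t_val n m k = (-1) ^ (n - 1) * (fib_poly (int n - 1) m)\<^sup>2 - k * fib_poly (int n) m"

definition beta :: "nat \<Rightarrow> int \<Rightarrow> int \<Rightarrow> real" where
  "beta n m k = sqrt (of_int ((s_val n m k)\<^sup>2 - 4 * t_val n m k))"

end

theory Submission
  imports Defs
begin

text \<open>
  A number \<open>x\<close> whose tail values \<open>X i = b i + 1 / X (i + 1)\<close> are all positive is the value of the
  continued fraction, since two consecutive steps shrink the error of a convergent by a factor 4;
  for a periodic expansion it therefore suffices to check a fixed-point equation.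
  Multiplying \<open>[m, m, \<dots>, m, y/2]\<close> by \<open>1/2\<close> alternately halves and doubles the partial quotients,
  which expresses \<open>[w(m), y]\<close> through the Fibonacci polynomials. The fixed-point equation at
  \<open>y = s + \<beta>\<close> then becomes a quadratic equation, and it holds by Cassini's identity.
\<close>

lemma cf_convergent_ge_1:
  assumes "\<And>i. b i > 0"
  shows "cf_convergent b j \<ge> 1"
  using assms
proof (induction j arbitrary: b)
  case 0
  have "b 0 \<ge> 1" using 0[of 0] by simp
  then show ?case by simp
next
  case (Suc j)
  have "cf_convergent (\<lambda>i. b (Suc i)) j \<ge> 1" by (rule Suc.IH) (rule Suc.prems)
  moreover have "b 0 \<ge> 1" using Suc.prems[of 0] by simp
  ultimately show ?case by (simp add: add_increasing2)
qed

text \<open>A single step need not contract by a fixed factor, since tails can be arbitrarily close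
  to 1; over two steps the denominators combine into two products that are each at least 2. The
  prefactor 2 makes the bound equal to 1 at \<open>j = 1\<close>, where the error is a difference of
  two numbers in [0, 1].\<close>

lemma cf_convergent_error:
  fixes X :: "nat \<Rightarrow> real"
  assumes "\<And>i. i \<ge> 1 \<Longrightarrow> b i > 0" and "\<And>i. i \<ge> 1 \<Longrightarrow> X i > 0"
    and "\<And>i. X i = of_int (b i) + 1 / X (Suc i)"
  shows "\<bar>cf_convergent b j - X 0\<bar> \<le> 2 * (1/2) ^ j"
  using assms
proof (induction j arbitrary: b X rule: induct_nat_012)
  case 0
  have "b 1 \<ge> 1" "X 2 > 0" using 0(1)[of 1] 0(2)[of 2] by auto
  then have "X 1 \<ge> 1"
    using 0(3)[of 1] by (simp add: numeral_2_eq_2 add_increasing2)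
  then have "0 \<le> 1 / X 1" "1 / X 1 \<le> 1" by auto
  then show ?case using 0(3)[of 0] by simp
next
  case 1
  have b: "real_of_int (b 1) \<ge> 1" and X2: "X 2 > 0" using 1(1)[of 1] 1(2)[of 2] by auto
  then have X: "X 1 \<ge> 1"
    using 1(3)[of 1] by (simp add: numeral_2_eq_2 add_increasing2)
  have "0 \<le> 1 / real_of_int (b 1)" "1 / real_of_int (b 1) \<le> 1" "0 \<le> 1 / X 1" "1 / X 1 \<le> 1"
    using b X by auto
  then have "\<bar>1 / real_of_int (b 1) - 1 / X 1\<bar> \<le> 1" by linarith
  then show ?case using 1(3)[of 0] by simp
next
  case (ge2 j)
  define c2 where "c2 = cf_convergent (\<lambda>i. b (Suc (Suc i))) j"
  define c1 where "c1 = real_of_int (b 1) + 1 / c2"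
  have c: "cf_convergent b (Suc (Suc j)) = real_of_int (b 0) + 1 / c1"
    by (simp add: c1_def c2_def)
  have c2: "c2 \<ge> 1"
    unfolding c2_def by (rule cf_convergent_ge_1) (simp add: ge2.prems(1))
  have b1: "real_of_int (b 1) \<ge> 1" and b2: "real_of_int (b 2) \<ge> 1"
    using ge2.prems(1)[of 1] ge2.prems(1)[of 2] by auto
  have "X 3 > 0" by (simp add: ge2.prems(2))
  then have X2: "X 2 \<ge> 1"
    using ge2.prems(3)[of 2] b2 by (simp add: numeral_3_eq_3 numeral_2_eq_2 add_increasing2)
  have X1: "X 1 = real_of_int (b 1) + 1 / X 2"
    using ge2.prems(3)[of 1] by (simp add: numeral_2_eq_2)
  \<comment> \<open>Clearing the denominator of \<open>c1\<close> leaves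
    \<open>b 1 * c2 + 1\<close>, a sum of two terms that are at least 1; the same works for
    \<open>X 1 * X 2\<close>.\<close>
  have cc: "c1 * c2 \<ge> 2"
  proof -
    have "c1 * c2 = real_of_int (b 1) * c2 + 1" using c2 by (simp add: c1_def field_simps)
    moreover have "real_of_int (b 1) * c2 \<ge> 1 * 1" using b1 c2 by (intro mult_mono) auto
    ultimately show ?thesis by simp
  qed
  have XX: "X 1 * X 2 \<ge> 2"
  proof -
    have "X 1 * X 2 = real_of_int (b 1) * X 2 + 1" using X2 unfolding X1 by (simp add: field_simps)
    moreover have "real_of_int (b 1) * X 2 \<ge> 1 * 1" using b1 X2 by (intro mult_mono) auto
    ultimately show ?thesis by simp
  qed
  have pos: "c1 > 0" "X 1 > 0" using c2 X2 b1 unfolding c1_def X1 by (auto simp: add_pos_pos)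
  have IH: "\<bar>c2 - X 2\<bar> \<le> 2 * (1/2) ^ j"
    unfolding c2_def numeral_2_eq_2
    by (rule ge2.IH(1)) (simp_all add: ge2.prems(1,2), rule ge2.prems(3))
  have "cf_convergent b (Suc (Suc j)) - X 0 = 1 / c1 - 1 / X 1"
    using ge2.prems(3)[of 0] c by simp
  also have "\<dots> = (X 1 - c1) / (c1 * X 1)" using pos by (simp add: field_simps)
  \<comment> \<open>Both sides share the partial quotient \<open>b 1\<close>, which cancels, so only
    the difference of the reciprocals remains.\<close>
  also have "X 1 - c1 = (c2 - X 2) / (c2 * X 2)"
    using c2 X2 unfolding X1 c1_def by (simp add: field_simps)
  also have "(c2 - X 2) / (c2 * X 2) / (c1 * X 1) = (c2 - X 2) / ((c1 * c2) * (X 1 * X 2))"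
    by (simp add: mult_ac)
  finally have eq: "\<bar>cf_convergent b (Suc (Suc j)) - X 0\<bar> = \<bar>c2 - X 2\<bar> / ((c1 * c2) * (X 1 * X 2))"
    using pos c2 X2 by (simp add: abs_mult)
  have "(c1 * c2) * (X 1 * X 2) \<ge> 2 * 2" using cc XX by (intro mult_mono) auto
  then have "\<bar>c2 - X 2\<bar> / ((c1 * c2) * (X 1 * X 2)) \<le> \<bar>c2 - X 2\<bar> / 4"
    by (intro divide_left_mono) auto
  also have "\<dots> \<le> 2 * (1/2) ^ j / 4" using IH by (rule divide_right_mono) simp
  also have "\<dots> = 2 * (1/2) ^ Suc (Suc j)" by simp
  finally show ?case unfolding eq .
qed

text \<open>The recurrence alone does not determine the value, as it can be solved forwards from a
  generic \<open>X 0\<close>; positivity of the tails singles out the limit of the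
  convergents.\<close>

lemma has_simple_cfI:
  fixes X :: "nat \<Rightarrow> real"
  assumes "\<And>i. i \<ge> 1 \<Longrightarrow> b i > 0" and "\<And>i. i \<ge> 1 \<Longrightarrow> X i > 0"
    and "\<And>i. X i = of_int (b i) + 1 / X (Suc i)"
  shows "has_simple_cf (X 0) b"
proof -
  have "(\<lambda>j. cf_convergent b j - X 0) \<longlonglongrightarrow> 0"
  proof (rule tendsto_0_le)
    show "(\<lambda>j. (1/2) ^ j :: real) \<longlonglongrightarrow> 0" by (rule LIMSEQ_power_zero) simp
    show "\<forall>\<^sub>F j in sequentially. norm (cf_convergent b j - X 0) \<le> norm ((1/2) ^ j :: real) * 2"
      using cf_convergent_error[of b X, OF assms] by (simp add: mult.commute)
  qed
  then show ?thesis
    unfolding has_simple_cf_def using assms(1) by (auto simp: LIM_zero_iff)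
qed

text \<open>A finite continued fraction whose last entry \<open>z\<close> is an arbitrary real
  complete quotient, so that concatenating blocks becomes composition of functions of
  \<open>z\<close>.\<close>

definition cf_fold :: "int list \<Rightarrow> real \<Rightarrow> real" where
  "cf_fold bs z = foldr (\<lambda>b y. of_int b + 1 / y) bs z"

lemma cf_fold_simps [simp]:
  "cf_fold [] z = z"
  "cf_fold (b # bs) z = of_int b + 1 / cf_fold bs z"
  "cf_fold (bs @ cs) z = cf_fold bs (cf_fold cs z)"
  by (simp_all add: cf_fold_def)

lemma cf_fold_pos:
  assumes "z > 0" and "\<And>b. b \<in> set bs \<Longrightarrow> b > 0"
  shows "cf_fold bs z > 0"
  using assms(2) by (induction bs) (auto simp: assms(1) add_pos_pos)

text \<open>The complete quotient at a position inside the period is the rest of the block followed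
  by \<open>z\<close>, and the fixed-point equation closes the cycle.\<close>

lemma has_simple_cf_periodic_after:
  assumes "z > 0" and "ws \<noteq> []" and pos: "\<And>b. b \<in> set ws \<Longrightarrow> b > 0"
    and fixpt: "cf_fold ws z = z"
  shows "has_simple_cf (of_int b0 + 1 / z) (periodic_after b0 ws)"
proof -
  define X where "X i = (if i = 0 then of_int b0 + 1 / z
    else cf_fold (drop ((i - 1) mod length ws) ws) z)" for i
  have len: "length ws > 0" using assms(2) by simp
  have "has_simple_cf (X 0) (periodic_after b0 ws)"
  proof (rule has_simple_cfI)
    show "periodic_after b0 ws i > 0" if "i \<ge> 1" for i
      using that pos len by (simp add: periodic_after_def)
    show "X i > 0" if "i \<ge> 1" for i
      using that cf_fold_pos[OF \<open>z > 0\<close>, of "drop ((i - 1) mod length ws) ws"]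
      by (auto simp: X_def dest: in_set_dropD intro: pos)
    show "X i = of_int (periodic_after b0 ws i) + 1 / X (Suc i)" for i
    proof (cases i)
      case 0
      then show ?thesis by (simp add: X_def periodic_after_def fixpt)
    next
      case (Suc l)
      define r where "r = l mod length ws"
      have r: "r < length ws" using len by (simp add: r_def)
      have "cf_fold (drop r ws) z = of_int (ws ! r) + 1 / cf_fold (drop (Suc r) ws) z"
        using Cons_nth_drop_Suc[OF r] by (metis cf_fold_simps(2))
      \<comment> \<open>Only the wrap-around matters: there the left side is the empty block, with
        value \<open>z\<close>, and the right side is the whole block, with the same value by
        \<open>fixpt\<close>.\<close>
      moreover have "cf_fold (drop (Suc r) ws) z = cf_fold (drop (Suc l mod length ws) ws) z"
        using fixpt by (simp add: mod_Suc r_def)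
      ultimately show ?thesis by (simp add: Suc X_def periodic_after_def r_def)
    qed
  qed
  then show ?thesis by (simp add: X_def)
qed

lemma fib_nat_nonneg: "m \<ge> 0 \<Longrightarrow> fib_nat h m \<ge> 0"
  by (induction h m rule: fib_nat.induct) auto

lemma fib_nat_Suc_pos: "m > 0 \<Longrightarrow> fib_nat (Suc h) m > 0"
proof (induction h)
  case (Suc h)
  then show ?case by (simp add: add_pos_nonneg fib_nat_nonneg)
qed simp

text \<open>Cassini's identity: applying the recurrence shows that the left-hand side changes sign
  when \<open>h\<close> increases by 1.\<close>

lemma fib_nat_cassini:
  "(fib_nat (Suc h) m)\<^sup>2 - fib_nat (Suc (Suc h)) m * fib_nat h m = (-1) ^ h"
proof (induction h)
  case (Suc h)
  have "(fib_nat (Suc (Suc h)) m)\<^sup>2 - fib_nat (Suc (Suc (Suc h))) m * fib_nat (Suc h) m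
    = - ((fib_nat (Suc h) m)\<^sup>2 - fib_nat (Suc (Suc h)) m * fib_nat h m)"
    by (simp add: power2_eq_square algebra_simps)
  then show ?case using Suc by simp
qed simp

lemma fib_poly_of_nat [simp]: "fib_poly (int h) m = fib_nat h m"
  by (simp add: fib_poly_def)

text \<open>Covers the index -1 as well, which occurs as n - 2 in the bound on \<open>k\<close> when
  \<open>n = 1\<close>.\<close>

lemma fib_poly_int_minus_1: "fib_poly (int h - 1) m = fib_nat (Suc h) m - m * fib_nat h m"
proof (cases h)
  case 0
  then show ?thesis by (simp add: fib_poly_def)
next
  case (Suc l)
  then show ?thesis by simp
qed

lemma w_block_Suc_Suc: "w_block (Suc (Suc n)) m = m div 2 # 2 * m # w_block n m"
proof -
  have "[0..<Suc (Suc n)] = 0 # 1 # map (\<lambda>i. Suc (Suc i)) [0..<n]"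
    by (simp add: upt_conv_Cons map_Suc_upt del: upt_Suc flip: map_map[unfolded comp_def])
  then show ?thesis by (simp add: w_block_def del: upt_Suc)
qed

text \<open>Prefixing the pair m/2, 2m sends P/(2Q) to (m P' + P)/(2P') with P' = m P + Q, which is
  two steps of the Fibonacci recurrence. The inner factors 2 come from the last entry y/2 of the
  unscaled fraction.\<close>

lemma cf_fold_w_block:
  fixes y :: real
  assumes "m > 0" and "even m" and "y > 0"
  shows "cf_fold (w_block (Suc (2 * j)) m) y =
    (fib_nat (2 * j + 2) m * y + 2 * fib_nat (2 * j + 1) m) /
    (2 * (fib_nat (2 * j + 1) m * y + 2 * fib_nat (2 * j) m))"
proof (induction j)
  case 0
  from \<open>even m\<close> obtain a where "m = 2 * a" by blast
  with \<open>y > 0\<close> show ?case by (simp add: w_block_def field_simps)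
next
  case (Suc j)
  define A B C where "A = real_of_int (fib_nat (2 * j + 2) m)"
    and "B = real_of_int (fib_nat (2 * j + 1) m)" and "C = real_of_int (fib_nat (2 * j) m)"
  define P Q where "P = A * y + 2 * B" and "Q = B * y + 2 * C"
  have A: "A > 0" and B: "B > 0" and C: "C \<ge> 0"
    using fib_nat_Suc_pos[OF \<open>m > 0\<close>, of "2 * j"] fib_nat_Suc_pos[OF \<open>m > 0\<close>, of "2 * j + 1"]
      fib_nat_nonneg[of m "2 * j"] \<open>m > 0\<close> by (auto simp: A_def B_def C_def simp del: fib_nat.simps)
  have PQ: "P > 0" "Q > 0" using A B C \<open>y > 0\<close> by (auto simp: P_def Q_def add_pos_nonneg add_pos_pos)
  define P' where "P' = m * P + Q"
  have P': "P' > 0" using PQ \<open>m > 0\<close> by (simp add: P'_def add_pos_pos)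
  have m2: "real_of_int (m div 2) = m / 2" using \<open>even m\<close> by (auto elim: evenE)
  have "cf_fold (w_block (Suc (2 * Suc j)) m) y = m / 2 + 1 / (2 * m + 1 / (P / (2 * Q)))"
    using Suc by (simp add: w_block_Suc_Suc m2 A_def B_def C_def P_def Q_def)
  also have "2 * m + 1 / (P / (2 * Q)) = 2 * P' / P"
    using PQ by (simp add: P'_def field_simps)
  also have "m / 2 + 1 / (2 * P' / P) = (m * P' + P) / (2 * P')"
    using P' by (simp add: field_simps)
  also have "P' = fib_nat (2 * Suc j + 1) m * y + 2 * fib_nat (2 * Suc j) m"
    by (simp add: P'_def P_def Q_def A_def B_def C_def algebra_simps)
  also have "m * \<dots> + P = fib_nat (2 * Suc j + 2) m * y + 2 * fib_nat (2 * Suc j + 1) m"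
    by (simp add: P_def A_def B_def algebra_simps)
  finally show ?case .
qed

theorem theorem3p6:
  fixes m k :: int and n :: nat
  assumes "m > 0" and "n > 0" and "even m" and "odd n"
    and "k \<ge> fib_poly (int n - 2) m + 1"
  shows "has_simple_cf (beta n m k)
           (periodic_after (s_val n m k) (w_block n m @ [2 * s_val n m k]))"
proof -
  from \<open>odd n\<close> obtain j where n: "n = Suc (2 * j)" by (auto elim: oddE)
  define A B C where "A = fib_nat (2 * j + 2) m" and "B = fib_nat (2 * j + 1) m"
    and "C = fib_nat (2 * j) m"
  define s t where "s = s_val n m k" and "t = t_val n m k"
  have A: "A = m * B + C" by (simp add: A_def B_def C_def)
  have pos: "A > 0" "B > 0" "C \<ge> 0"
    using fib_nat_Suc_pos[OF \<open>m > 0\<close>, of "2 * j"] fib_nat_Suc_pos[OF \<open>m > 0\<close>, of "2 * j + 1"]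
      fib_nat_nonneg[of m "2 * j"] \<open>m > 0\<close> by (auto simp: A_def B_def C_def)
  have cassini: "B\<^sup>2 = A * C + 1"
    using fib_nat_cassini[of "2 * j" m] by (simp add: A_def B_def C_def)
  have fib: "fib_poly (int n) m = B" "fib_poly (int n - 1) m = C" "fib_poly (int n + 1) m = A"
    using fib_poly_of_nat[of n m] fib_poly_of_nat[of "2 * j" m] fib_poly_of_nat[of "n + 1" m]
    by (simp_all add: n A_def B_def C_def add.commute)
  have s: "s = k * A - B * C" and t: "t = C\<^sup>2 - k * B"
    using \<open>odd n\<close> unfolding s_def t_def s_val_def t_val_def fib by (simp_all add: n)
  have "k \<ge> B - m * C + 1"
    using assms(5) fib_poly_int_minus_1[of "2 * j" m] by (simp add: n B_def C_def)
  then have "k * A \<ge> (B - m * C + 1) * A" using pos by (intro mult_right_mono) auto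
  \<comment> \<open>By Cassini the right side is \<open>m + A + B * C\<close>, hence
    \<open>s \<ge> m + A\<close>.\<close>
  also have "(B - m * C + 1) * A = m * (B\<^sup>2 - A * C) + A + B * C"
    by (simp add: A power2_eq_square algebra_simps)
  finally have s_pos: "s > 0" using pos \<open>m > 0\<close> by (simp add: s cassini)
  \<comment> \<open>This relation serves twice: it forces \<open>t < 0\<close>, and it makes the
    fixed-point equation hold.\<close>
  have key: "s * B + C = - t * A"
  proof -
    have "s * B + C + t * A = C * (A * C + 1 - B\<^sup>2)"
      by (simp add: s t power2_eq_square algebra_simps)
    then show ?thesis using cassini by simp
  qed
  have "s * B + C > 0" using s_pos pos by (simp add: add_pos_nonneg)
  then have "t * A < 0" by (simp add: key)
  then have t_neg: "t < 0" using pos by (simp add: mult_less_0_iff)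
  define \<beta> where "\<beta> = beta n m k"
  have disc: "s\<^sup>2 - 4 * t > 0" using t_neg by (smt (verit) zero_le_power2)
  then have beta2: "\<beta>\<^sup>2 = s\<^sup>2 - 4 * t" and beta_pos: "\<beta> > 0"
    by (simp_all add: \<beta>_def beta_def flip: s_def t_def)
      (simp_all flip: of_int_power of_int_mult of_int_diff)
  \<comment> \<open>This is the complete quotient at the entry \<open>2 * s\<close>: if
    \<open>\<beta> = s + 1 / z\<close>, then \<open>2 * s + 1 / z = s + \<beta>\<close>.\<close>
  define y where "y = s + \<beta>"
  have y: "y > 0" using s_pos beta_pos by (simp add: y_def)
  define P Q where "P = A * y + 2 * B" and "Q = B * y + 2 * C"
  have PQ: "P > 0" "Q > 0" using pos y by (auto simp: P_def Q_def add_pos_nonneg add_pos_pos)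
  define z where "z = P / (2 * Q)"
  have z: "cf_fold (w_block n m) y = z"
    using cf_fold_w_block[OF \<open>m > 0\<close> \<open>even m\<close> y, of j]
    by (simp add: n z_def P_def Q_def A_def B_def C_def)
  have z_pos: "z > 0" using PQ by (simp add: z_def)
  \<comment> \<open>The equation \<open>1 / z = \<beta> - s\<close> without denominators. The terms
    linear in \<open>\<beta>\<close> cancel because \<open>B\<close> occurs in both \<open>P\<close>
    and \<open>Q\<close>; the rest vanishes by \<open>beta2\<close> and \<open>key\<close>.\<close>
  have "(\<beta> - s) * P = 2 * Q"
  proof -
    have "(\<beta> - s) * P - 2 * Q = (\<beta>\<^sup>2 - s\<^sup>2) * A - 4 * of_int (s * B + C)"
      by (simp add: P_def Q_def y_def power2_eq_square algebra_simps)
    also have "\<dots> = 0" unfolding key by (simp add: beta2)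
    finally show ?thesis by simp
  qed
  then have inv_z: "1 / z = \<beta> - s" using PQ by (simp add: z_def field_simps)
  have "has_simple_cf (s + 1 / z) (periodic_after s (w_block n m @ [2 * s]))"
  proof (rule has_simple_cf_periodic_after)
    show "b > 0" if "b \<in> set (w_block n m @ [2 * s])" for b
      using that \<open>m > 0\<close> \<open>even m\<close> s_pos by (auto simp: w_block_def elim!: evenE split: if_splits)
    have "cf_fold [2 * s] z = y" using inv_z by (simp add: y_def)
    then show "cf_fold (w_block n m @ [2 * s]) z = z" using z by simp
  qed (use z_pos in auto)
  then show ?thesis using inv_z by (simp add: \<beta>_def s_def)
qed

end
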